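(* Let $P$ be a $\sigma$-program. The binary relation $<_P$ on $\mathrm{Lab}_P$ is irreflexive and a strict order. For $B',B''\in\mathrm{Lab}_P$, the relationships $B'\not<_P B''$ and $B''\not<_P B'$ together mean $B'=B''$. The relation $\le_P$ is a total (or linear) order: it is reflexive, antisymmetric, transitive, and total.
   Context: **Programs.** Let $\sigma=(n_1;m_1,\ldots,m_{n_2};k_1,\ldots,k_{n_3})$ be a finite signature with constant symbols $c_i^0$, operation symbols $f_i^{m_i}$, relation symbols $r_i^{k_i}$. A $\sigma$-program $P$ is a list $1:\mathrm{instruction}_1;\ \ldots;\ \ell_P-1:\mathrm{instruction}_{\ell_P-1};\ \ell_P:\text{stop}$ with $\ell_P\ge1$, where each instruction with label $\ell<\ell_P$ has one of the forms: (1) $Z_j:=f_i^{m_i}(Z_{j_1},\ldots,Z_{j_{m_i}})$; (2) $Z_j:=c_i^0$; (3) $Z_{I_j}:=Z_{I_k}$; (4) if $r_i^{k_i}(Z_{j_1},\ldots,Z_{j_{k_i}})$ then goto $\ell_1'$ else goto $\ell_2'$; (5) if $I_j=I_k$ then goto $\ell_1'$ else goto $\ell_2'$; (6) $I_j:=1$; (7) $I_j:=I_j+1$; (11) goto $\ell_1'$ or goto $\ell_2'$; with $\ell_1',\ell_2'\in L_P=\{1,\ldots,\ell_P\}$. Let $L_P^{\circ}=\{1,\ldots,\ell_P-1\}$, $L_P^{\mathrm B}$ = labels of types (4),(5),(11), $L_P^{\mathrm{NB}}=L_P^\circ\setminus L_P^{\mathrm B}$. Put $\beta_P(\ell)=\ell+1$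 for $\ell\in L_P^{\mathrm{NB}}$ and, for $\ell\in L_P^{\mathrm B}$, $\beta_P^+(\ell)=\ell_1'$, $\beta_P^-(\ell)=\ell_2'$. **$P$-paths.** A finite $P$-path of length $s\ge1$ is $(\ell_1,\ldots,\ell_s)\in L_P^s$ with $\ell_1=1$, $\ell_s=\ell_P$, $\ell_t\in L_P^\circ$ for $t<s$, and for all $t<s$: $\ell_{t+1}=\beta_P(\ell_t)$ if $\ell_t\in L_P^{\mathrm{NB}}$, $\ell_{t+1}\in\{\beta_P^+(\ell_t),\beta_P^-(\ell_t)\}$ if $\ell_t\in L_P^{\mathrm B}$. An infinite $P$-path is $(\ell_1,\ell_2,\ldots)\in (L_P^\circ)^\omega$ with $\ell_1=1$ and the same successor rule for all $t\ge 1$. $\mathrm{Lab}_P$ is the set of all (finite and infinite) $P$-paths. **The order.** For $P$-paths $B^{(1)}=(\ell_{1,1},\ell_{1,2},\ldots)$ and $B^{(2)}=(\ell_{2,1},\ell_{2,2},\ldots)$ (each finite or infinite), $B^{(1)}<_PB^{(2)}$ holds iff there is $j\in\{2,3,\ldots\}$, not exceeding the length of any of the two paths that is finite, with $\ell_{1,i}=\ell_{2,i}$ for all $i\in\{1,\ldots,j-1\}$, $\ell_{1,j}\ne\ell_{2,j}$, $\ell_{1,j}=\beta_P^+(\ell_{1,j-1})$ and $\ell_{2,j}=\beta_P^-(\ell_{1,j-1})$. $B^{(1)}\le_PB^{(2)}$ means $B^{(1)}<_PB^{(2)}$ or $B^{(1)}=B^{(2)}$. *)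

theory Defs
  imports Main "HOL-Library.Extended_Nat" "HOL-Library.Stream"
begin

text \<open>
  A signature \<open>(n\<^sub>1; m\<^sub>1, \<dots>, m\<^bsub>n\<^sub>2\<^esub>; k\<^sub>1, \<dots>, k\<^bsub>n\<^sub>3\<^esub>)\<close>; the numbers \<open>n\<^sub>2\<close> and \<open>n\<^sub>3\<close> are the lengths
  of the two lists of arities. Symbols, registers and labels are all numbered from 1.
\<close>

record signature =
  num_consts :: nat
  op_arities :: "nat list"
  rel_arities :: "nat list"

type_synonym label = nat

datatype instr =
    Op nat nat "nat list"               \<comment> \<open>\<open>Op j i js\<close>: \<open>Z\<^sub>j := f\<^sub>i(Z\<^bsub>j\<^sub>1\<^esub>, \<dots>)\<close>\<close>
  | Const nat nat                       \<comment> \<open>\<open>Const j i\<close>: \<open>Z\<^sub>j := c\<^sub>i\<close>\<close>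
  | Copy nat nat                        \<comment> \<open>\<open>Copy j k\<close>: \<open>Z\<^bsub>I\<^sub>j\<^esub> := Z\<^bsub>I\<^sub>k\<^esub>\<close>\<close>
  | If_Rel nat "nat list" label label   \<comment> \<open>if \<open>r\<^sub>i(Z\<^bsub>j\<^sub>1\<^esub>, \<dots>)\<close> then goto \<open>\<dots>\<close> else goto \<open>\<dots>\<close>\<close>
  | If_Index_Eq nat nat label label     \<comment> \<open>if \<open>I\<^sub>j = I\<^sub>k\<close> then goto \<open>\<dots>\<close> else goto \<open>\<dots>\<close>\<close>
  | Index_One nat                       \<comment> \<open>\<open>I\<^sub>j := 1\<close>\<close>
  | Index_Inc nat                       \<comment> \<open>\<open>I\<^sub>j := I\<^sub>j + 1\<close>\<close>
  | Goto_Or label label                 \<comment> \<open>goto \<open>\<dots>\<close> or goto \<open>\<dots>\<close>\<close>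
  | Stop

text \<open>The \<open>\<ell>\<close>-th entry of the list is the instruction with label \<open>\<ell>\<close>.\<close>

type_synonym program = "instr list"

definition labels :: "program \<Rightarrow> label set" where
  "labels P = {1..length P}"

definition instr_at :: "program \<Rightarrow> label \<Rightarrow> instr" where
  "instr_at P l = P ! (l - 1)"

fun wf_instr :: "signature \<Rightarrow> program \<Rightarrow> instr \<Rightarrow> bool" where
  "wf_instr \<sigma> P (Op j i js) \<longleftrightarrow>
     1 \<le> j \<and> i \<in> {1..length (op_arities \<sigma>)} \<and>
     length js = op_arities \<sigma> ! (i - 1) \<and> (\<forall>k \<in> set js. 1 \<le> k)"
| "wf_instr \<sigma> P (Const j i) \<longleftrightarrow> 1 \<le> j \<and> i \<in> {1..num_consts \<sigma>}"
| "wf_instr \<sigma> P (Copy j k) \<longleftrightarrow> 1 \<le> j \<and> 1 \<le> k"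
| "wf_instr \<sigma> P (If_Rel i js l1 l2) \<longleftrightarrow>
     i \<in> {1..length (rel_arities \<sigma>)} \<and>
     length js = rel_arities \<sigma> ! (i - 1) \<and> (\<forall>k \<in> set js. 1 \<le> k) \<and>
     l1 \<in> labels P \<and> l2 \<in> labels P"
| "wf_instr \<sigma> P (If_Index_Eq j k l1 l2) \<longleftrightarrow>
     1 \<le> j \<and> 1 \<le> k \<and> l1 \<in> labels P \<and> l2 \<in> labels P"
| "wf_instr \<sigma> P (Index_One j) \<longleftrightarrow> 1 \<le> j"
| "wf_instr \<sigma> P (Index_Inc j) \<longleftrightarrow> 1 \<le> j"
| "wf_instr \<sigma> P (Goto_Or l1 l2) \<longleftrightarrow> l1 \<in> labels P \<and> l2 \<in> labels P"
| "wf_instr \<sigma> P Stop \<longleftrightarrow> False"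

text \<open>
  Since \<open>wf_instr\<close> rejects \<open>Stop\<close>, the stop instruction occurs exactly once, at the last label.
\<close>

definition is_program :: "signature \<Rightarrow> program \<Rightarrow> bool" where
  "is_program \<sigma> P \<longleftrightarrow>
     P \<noteq> [] \<and> last P = Stop \<and> (\<forall>ins \<in> set (butlast P). wf_instr \<sigma> P ins)"

text \<open>All labels but the last one, which carries \<open>Stop\<close>.\<close>

definition inner_labels :: "program \<Rightarrow> label set" where
  "inner_labels P = {1..<length P}"

fun is_branch :: "instr \<Rightarrow> bool" where
  "is_branch (If_Rel i js l1 l2) = True"
| "is_branch (If_Index_Eq j k l1 l2) = True"
| "is_branch (Goto_Or l1 l2) = True"
| "is_branch _ = False"

definition branch_labels :: "program \<Rightarrow> label set" where
  "branch_labels P = {l \<in> inner_labels P. is_branch (instr_at P l)}"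

definition nonbranch_labels :: "program \<Rightarrow> label set" where
  "nonbranch_labels P = inner_labels P - branch_labels P"

text \<open>
  \<open>beta\<close> is meant for labels in \<open>nonbranch_labels P\<close>, while \<open>beta_plus\<close> and \<open>beta_minus\<close>
  are meant for labels in \<open>branch_labels P\<close>.
\<close>

definition beta :: "program \<Rightarrow> label \<Rightarrow> label" where
  "beta P l = l + 1"

definition beta_plus :: "program \<Rightarrow> label \<Rightarrow> label" where
  "beta_plus P l = (case instr_at P l of
       If_Rel i js l1 l2 \<Rightarrow> l1
     | If_Index_Eq j k l1 l2 \<Rightarrow> l1
     | Goto_Or l1 l2 \<Rightarrow> l1
     | _ \<Rightarrow> undefined)"

definition beta_minus :: "program \<Rightarrow> label \<Rightarrow> label" where
  "beta_minus P l = (case instr_at P l of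
       If_Rel i js l1 l2 \<Rightarrow> l2
     | If_Index_Eq j k l1 l2 \<Rightarrow> l2
     | Goto_Or l1 l2 \<Rightarrow> l2
     | _ \<Rightarrow> undefined)"

definition successor :: "program \<Rightarrow> label \<Rightarrow> label \<Rightarrow> bool" where
  "successor P l l' \<longleftrightarrow>
     (l \<in> nonbranch_labels P \<longrightarrow> l' = beta P l) \<and>
     (l \<in> branch_labels P \<longrightarrow> l' \<in> {beta_plus P l, beta_minus P l})"

datatype label_seq = Fin "label list" | Inf "label stream"

fun seq_length :: "label_seq \<Rightarrow> enat" where
  "seq_length (Fin ls) = enat (length ls)"
| "seq_length (Inf s) = \<infinity>"

text \<open>\<open>label_at B t\<close> is the \<open>t\<close>-th label of \<open>B\<close>, counted from \<open>t = 1\<close>.\<close>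

fun label_at :: "label_seq \<Rightarrow> nat \<Rightarrow> label" where
  "label_at (Fin ls) t = ls ! (t - 1)"
| "label_at (Inf s) t = s !! (t - 1)"

definition is_finite_path :: "program \<Rightarrow> label list \<Rightarrow> bool" where
  "is_finite_path P ls \<longleftrightarrow>
     1 \<le> length ls \<and> set ls \<subseteq> labels P \<and>
     label_at (Fin ls) 1 = 1 \<and> label_at (Fin ls) (length ls) = length P \<and>
     (\<forall>t. 1 \<le> t \<and> t < length ls \<longrightarrow>
        label_at (Fin ls) t \<in> inner_labels P \<and>
        successor P (label_at (Fin ls) t) (label_at (Fin ls) (t + 1)))"

definition is_infinite_path :: "program \<Rightarrow> label stream \<Rightarrow> bool" where
  "is_infinite_path P s \<longleftrightarrow>
     sset s \<subseteq> inner_labels P \<and> label_at (Inf s) 1 = 1 \<and>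
     (\<forall>t \<ge> 1. successor P (label_at (Inf s) t) (label_at (Inf s) (t + 1)))"

definition Lab :: "program \<Rightarrow> label_seq set" where
  "Lab P = Fin ` {ls. is_finite_path P ls} \<union> Inf ` {s. is_infinite_path P s}"

text \<open>
  The membership in \<open>branch_labels P\<close> makes explicit that \<open>\<beta>\<^sub>P\<^sup>+\<close> and \<open>\<beta>\<^sub>P\<^sup>-\<close> are defined
  at the last common label; for elements of \<open>Lab P\<close> it follows from the two paths differing
  at \<open>j\<close>, as non-branching labels have only one successor.
\<close>

definition path_less :: "program \<Rightarrow> label_seq \<Rightarrow> label_seq \<Rightarrow> bool" where
  "path_less P B1 B2 \<longleftrightarrow>
     (\<exists>j \<ge> 2. enat j \<le> seq_length B1 \<and> enat j \<le> seq_length B2 \<and>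
        (\<forall>i \<in> {1..j - 1}. label_at B1 i = label_at B2 i) \<and>
        label_at B1 j \<noteq> label_at B2 j \<and>
        label_at B1 (j - 1) \<in> branch_labels P \<and>
        label_at B1 j = beta_plus P (label_at B1 (j - 1)) \<and>
        label_at B2 j = beta_minus P (label_at B1 (j - 1)))"

definition path_le :: "program \<Rightarrow> label_seq \<Rightarrow> label_seq \<Rightarrow> bool" where
  "path_le P B1 B2 \<longleftrightarrow> path_less P B1 B2 \<or> B1 = B2"

end

theory Submission
  imports Defs
begin

text \<open>
  Two paths that differ do so first at a step after a common branch label, where one of them takes
  \<open>\<beta>\<^sub>P\<^sup>+\<close> and the other \<open>\<beta>\<^sub>P\<^sup>-\<close>; no path is a proper prefix of another because the label \<open>\<ell>\<^sub>P\<close>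
  ends a path. So \<open><\<^sub>P\<close> is a lexicographic order.
\<close>

lemma path_less_irrefl: "\<not> path_less P B B"
  by (auto simp: path_less_def)

text \<open>The smaller of the two deciding positions witnesses the composite. They cannot coincide:
  \<open>B2\<close> would take both \<open>beta_minus\<close> and \<open>beta_plus\<close> there,
  hence agree with \<open>B1\<close>. Nothing about paths is used, so the result covers arbitrary
  label sequences.\<close>

lemma path_less_trans:
  assumes "path_less P B1 B2" "path_less P B2 B3"
  shows "path_less P B1 B3"
proof -
  obtain j where j: "j \<ge> 2" "enat j \<le> seq_length B1" "enat j \<le> seq_length B2"
    "\<And>i. i \<in> {1..j - 1} \<Longrightarrow> label_at B1 i = label_at B2 i"
    "label_at B1 j \<noteq> label_at B2 j" "label_at B1 (j - 1) \<in> branch_labels P"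
    "label_at B1 j = beta_plus P (label_at B1 (j - 1))"
    "label_at B2 j = beta_minus P (label_at B1 (j - 1))"
    using assms(1) unfolding path_less_def by blast
  obtain k where k: "k \<ge> 2" "enat k \<le> seq_length B2" "enat k \<le> seq_length B3"
    "\<And>i. i \<in> {1..k - 1} \<Longrightarrow> label_at B2 i = label_at B3 i"
    "label_at B2 k \<noteq> label_at B3 k" "label_at B2 (k - 1) \<in> branch_labels P"
    "label_at B2 k = beta_plus P (label_at B2 (k - 1))"
    "label_at B3 k = beta_minus P (label_at B2 (k - 1))"
    using assms(2) unfolding path_less_def by blast
  have j1: "label_at B1 (j - 1) = label_at B2 (j - 1)"
    using j(1,4) by simp
  consider "j < k" | "j = k" | "k < j" by linarith
  then show ?thesis
  proof cases
    case 1
    then have eq: "label_at B2 j = label_at B3 j"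
      using j(1) k(4) by simp
    have "enat j \<le> seq_length B3"
      using 1 k(3) order_trans[of "enat j" "enat k"] by simp
    moreover have "\<forall>i\<in>{1..j - 1}. label_at B1 i = label_at B3 i"
      using 1 j(4) k(4) by auto
    ultimately show ?thesis
      unfolding path_less_def using j eq by metis
  next
    case 2
    then have False using j(5,7) j1 k(7) by simp
    then show ?thesis ..
  next
    case 3
    \<comment> \<open>The bound \<open>k \<ge> 2\<close> puts \<open>k - 1\<close> in range as well,
      so the branch label of \<open>B2\<close> before \<open>k\<close> is also that of
      \<open>B1\<close>.\<close>
    then have "k \<in> {1..j - 1}" "k - 1 \<in> {1..j - 1}"
      using k(1) unfolding atLeastAtMost_iff by linarith+
    then have eq: "label_at B1 k = label_at B2 k" "label_at B1 (k - 1) = label_at B2 (k - 1)"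
      using j(4) by blast+
    have "enat k \<le> seq_length B1"
      using 3 j(2) order_trans[of "enat k" "enat j"] by simp
    moreover have "\<forall>i\<in>{1..k - 1}. label_at B1 i = label_at B3 i"
      using 3 j(4) k(4) by auto
    ultimately show ?thesis
      unfolding path_less_def using k eq by metis
  qed
qed

lemma path_less_asym: "path_less P B1 B2 \<Longrightarrow> \<not> path_less P B2 B1"
  using path_less_trans path_less_irrefl by blast

lemma path_first_label: "B \<in> Lab P \<Longrightarrow> label_at B 1 = 1"
  by (auto simp: Lab_def is_finite_path_def is_infinite_path_def)

lemma path_step:
  assumes "B \<in> Lab P" "1 \<le> t" "enat t < seq_length B"
  shows "label_at B t \<in> inner_labels P" "successor P (label_at B t) (label_at B (t + 1))"
  using assms by (auto simp: Lab_def is_finite_path_def is_infinite_path_def)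

text \<open>A finite path ends in \<open>length P\<close>, which the half-open interval
  \<open>inner_labels\<close> omits; for an infinite path no natural number \<open>t\<close>
  satisfies the second hypothesis.\<close>

lemma path_last_label_not_inner:
  assumes "B \<in> Lab P" "enat t = seq_length B"
  shows "label_at B t \<notin> inner_labels P"
  using assms by (auto simp: Lab_def is_finite_path_def inner_labels_def)

lemma path_length_ge_1:
  assumes "B \<in> Lab P"
  shows "enat 1 \<le> seq_length B"
  using assms by (auto simp: Lab_def is_finite_path_def)

text \<open>Only \<open>Inf\<close> has length \<open>\<infinity>\<close>, so equal lengths force
  equal constructors, and extensionality of lists or streams applies. Positions count from 1, whence
  the \<open>Suc\<close> shifts.\<close>

lemma label_seq_eqI:
  assumes "seq_length B1 = seq_length B2"
    and eq: "\<And>t. 1 \<le> t \<Longrightarrow> enat t \<le> seq_length B1 \<Longrightarrow> label_at B1 t = label_at B2 t"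
  shows "B1 = B2"
proof (cases B1)
  case B1: (Fin xs)
  then obtain ys where B2: "B2 = Fin ys" "length xs = length ys"
    using assms(1) by (cases B2) auto
  have "xs ! i = ys ! i" if "i < length xs" for i
    using eq[of "Suc i"] that B1 B2 by simp
  then show ?thesis using B1 B2 by (simp add: nth_equalityI)
next
  case B1: (Inf s)
  then obtain s' where B2: "B2 = Inf s'"
    using assms(1) by (cases B2) auto
  have "s !! n = s' !! n" for n
    using eq[of "Suc n"] B1 B2 by simp
  \<comment> \<open>\<open>smap_alt\<close> describes \<open>smap f s = s'\<close> pointwise; taking
    the identity for \<open>f\<close> gives stream extensionality.\<close>
  then have "s = s'"
    by (metis ext smap_alt stream.map_id0 id_apply)
  then show ?thesis using B1 B2 by simp
qed

text \<open>At the last position of a strictly shorter \<open>B1\<close> its label is not inner,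
  while \<open>B2\<close> continues beyond that position and so has an inner label there, against
  \<open>eq\<close>.\<close>

lemma path_not_shorter:
  assumes "B1 \<in> Lab P" "B2 \<in> Lab P"
    and eq: "\<And>t. 1 \<le> t \<Longrightarrow> enat t \<le> seq_length B1 \<Longrightarrow> enat t \<le> seq_length B2 \<Longrightarrow>
      label_at B1 t = label_at B2 t"
  shows "\<not> seq_length B1 < seq_length B2"
proof
  assume less: "seq_length B1 < seq_length B2"
  then obtain n where n: "seq_length B1 = enat n"
    by (cases "seq_length B1") auto
  then have "1 \<le> n" using path_length_ge_1[OF assms(1)] by simp
  then show False
    using eq[of n] n less path_last_label_not_inner[OF assms(1), of n]
      path_step(1)[OF assms(2), of n] by simp
qed

lemma path_less_total:
  assumes B: "B1 \<in> Lab P" "B2 \<in> Lab P" "B1 \<noteq> B2"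
  shows "path_less P B1 B2 \<or> path_less P B2 B1"
proof -
  let ?D = "\<lambda>t. 1 \<le> t \<and> enat t \<le> seq_length B1 \<and> enat t \<le> seq_length B2 \<and>
    label_at B1 t \<noteq> label_at B2 t"
  have "\<exists>t. ?D t"
  proof (rule ccontr)
    assume "\<not> ?thesis"
    then have eq: "\<And>t. 1 \<le> t \<Longrightarrow> enat t \<le> seq_length B1 \<Longrightarrow> enat t \<le> seq_length B2 \<Longrightarrow>
      label_at B1 t = label_at B2 t" by blast
    then have "seq_length B1 = seq_length B2"
      using path_not_shorter[OF B(1,2)] path_not_shorter[OF B(2,1)]
      by (metis linorder_neqE)
    then have "B1 = B2" using eq by (intro label_seq_eqI) auto
    with B(3) show False ..
  qed
  then obtain j where D: "?D j" and least: "\<And>t. t < j \<Longrightarrow> \<not> ?D t"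
    using exists_least_iff[of ?D] by blast
  \<comment> \<open>All paths start at label 1, so the first disagreement has a predecessor
    position.\<close>
  have "j \<noteq> 1" using D path_first_label B(1,2) by metis
  with D have j: "j \<ge> 2" by linarith
  have agree: "\<forall>i\<in>{1..j - 1}. label_at B1 i = label_at B2 i"
  proof
    fix i assume i: "i \<in> {1..j - 1}"
    then have "i < j" using j by auto
    then have "enat i \<le> enat j" by simp
    with D have "enat i \<le> seq_length B1" "enat i \<le> seq_length B2" by (meson order_trans)+
    with i least[OF \<open>i < j\<close>] show "label_at B1 i = label_at B2 i" by simp
  qed
  define l where "l = label_at B1 (j - 1)"
  have l: "label_at B1 (j - 1) = l" "label_at B2 (j - 1) = l"
    using agree j by (auto simp: l_def)
  have "enat (j - 1) < enat j" using j by simp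
  with D have lt: "enat (j - 1) < seq_length B1" "enat (j - 1) < seq_length B2"
    by (meson order_less_le_trans)+
  have "l \<in> inner_labels P" "successor P l (label_at B1 j)" "successor P l (label_at B2 j)"
    using path_step[OF B(1) _ lt(1)] path_step[OF B(2) _ lt(2)] j l by simp_all
  \<comment> \<open>A nonbranching \<open>l\<close> would force the single successor
    \<open>beta P l\<close> on both paths, contradicting their disagreement at
    \<open>j\<close>.\<close>
  then have "l \<in> branch_labels P"
    and "label_at B1 j \<in> {beta_plus P l, beta_minus P l}"
    and "label_at B2 j \<in> {beta_plus P l, beta_minus P l}"
    using D by (auto simp: successor_def nonbranch_labels_def)
  \<comment> \<open>Two different labels exhaust the pair of successors; the path taking
    \<open>beta_plus\<close> is the smaller one.\<close>
  then have "label_at B1 j = beta_plus P l \<and> label_at B2 j = beta_minus P l \<or>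
      label_at B2 j = beta_plus P l \<and> label_at B1 j = beta_minus P l"
    using D by auto
  then show ?thesis
    unfolding path_less_def using j D agree l \<open>l \<in> branch_labels P\<close> by metis
qed

theorem proposition4p22:
  fixes \<sigma> :: signature and P :: program
  assumes "is_program \<sigma> P"
  shows "irreflp_on (Lab P) (path_less P)
    \<and> asymp_on (Lab P) (path_less P)
    \<and> transp_on (Lab P) (path_less P)
    \<and> (\<forall>B' \<in> Lab P. \<forall>B'' \<in> Lab P.
         \<not> path_less P B' B'' \<and> \<not> path_less P B'' B' \<longrightarrow> B' = B'')
    \<and> reflp_on (Lab P) (path_le P)
    \<and> antisymp_on (Lab P) (path_le P)
    \<and> transp_on (Lab P) (path_le P)
    \<and> totalp_on (Lab P) (path_le P)"
proof (intro conjI)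
  show "irreflp_on (Lab P) (path_less P)"
    by (simp add: irreflp_on_def path_less_irrefl)
  show "asymp_on (Lab P) (path_less P)"
    by (simp add: asymp_on_def path_less_asym)
  show "transp_on (Lab P) (path_less P)"
    by (meson transp_onI path_less_trans)
  show "\<forall>B' \<in> Lab P. \<forall>B'' \<in> Lab P.
      \<not> path_less P B' B'' \<and> \<not> path_less P B'' B' \<longrightarrow> B' = B''"
    using path_less_total by blast
  show "reflp_on (Lab P) (path_le P)"
    by (simp add: reflp_on_def path_le_def)
  show "antisymp_on (Lab P) (path_le P)"
    unfolding antisymp_on_def path_le_def using path_less_asym by blast
  show "transp_on (Lab P) (path_le P)"
    unfolding transp_on_def path_le_def using path_less_trans by blast
  show "totalp_on (Lab P) (path_le P)"
    unfolding totalp_on_def path_le_def using path_less_total by blast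
qed

end
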